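(* Let $k\ge 2$ and $\varepsilon\in[0,k-1)$. Any data stream algorithm for $\mathtt{SMkM}$ whose only access to the matroids is via the common independence oracle, and whose expected approximation ratio is $k-\varepsilon$, must use $\Omega\!\left(\frac{\varepsilon n}{k^5\log k}\right)$ memory, where $n$ is the size of the ground set. This holds even when the task is to find a maximum size common independent set in $k$ partition matroids (i.e. $f(S)=|S|$), and the common rank of these matroids is $k$.
   Context: $\mathtt{SMkM}$ (Submodular Maximization subject to $k$ Matroid Constraints): given $k\ge 2$ matroids $M_1=(\mathcal N,\mathcal I_1),\dots,M_k=(\mathcal N,\mathcal I_k)$ on a common ground set $\mathcal N$, $|\mathcal N|=n$, and a non-negative submodular function $f:2^{\mathcal N}\to\mathbb R_{\ge0}$, find a common independent set $S$ (independent in all $k$ matroids) maximizing $f(S)$. The common rank of the matroids is the maximum cardinality of a common independent set. Data stream model: the elements of $\mathcal N$ arrive one by one in a stream; the (possibly randomized) algorithm makes a single pass and then outputs a common independent set. There is no restriction on computational power; memory is measured in bits. Expected approximation ratio $\beta$ means that on every instance the expected value of the output is at least $1/\beta$ times the optimal value. Common independence oracle: given $S\subseteq\mathcal N$, it reports whether $S\in\bigcap_{i=1}^k\mathcal I_i$; the algorithm has no way of testing independence in an individual matroid. The algorithm may query the oracle only on subsets of elements that have already appeared in the stream. The constant hidden in $\Omega(\cdot)$ is absolute. *)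

theory Defs
  imports "HOL-Probability.Probability_Mass_Function" "HOL-Library.Disjoint_Sets"
begin

definition is_matroid :: "'a set \<Rightarrow> 'a set set \<Rightarrow> bool" where
  "is_matroid N \<I> \<longleftrightarrow>
     finite N \<and> \<I> \<subseteq> Pow N \<and> {} \<in> \<I> \<and>
     (\<forall>S T. T \<in> \<I> \<and> S \<subseteq> T \<longrightarrow> S \<in> \<I>) \<and>
     (\<forall>S T. S \<in> \<I> \<and> T \<in> \<I> \<and> card S < card T \<longrightarrow> (\<exists>x \<in> T - S. insert x S \<in> \<I>))"

text \<open>Partition matroids with arbitrary block capacities (capacity 0 is allowed).\<close>

definition is_partition_matroid :: "'a set \<Rightarrow> 'a set set \<Rightarrow> bool" where
  "is_partition_matroid N \<I> \<longleftrightarrow>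
     finite N \<and>
     (\<exists>P (d :: 'a set \<Rightarrow> nat). partition_on N P \<and>
        \<I> = {S. S \<subseteq> N \<and> (\<forall>B \<in> P. card (S \<inter> B) \<le> d B)})"

definition submodular_on :: "'a set \<Rightarrow> ('a set \<Rightarrow> real) \<Rightarrow> bool" where
  "submodular_on N f \<longleftrightarrow>
     (\<forall>S T. S \<subseteq> N \<and> T \<subseteq> N \<longrightarrow> f (S \<union> T) + f (S \<inter> T) \<le> f S + f T)"

text \<open>Elements are identified by names, which are natural numbers. An input is the sequence in which
  the elements arrive, the list of the families of independent sets, and the objective function.
  Only the values of the objective function on subsets of the ground set are relevant.\<close>

datatype smkm_input = SMkM_Input
  (arrivals: "nat list")
  (matroids: "nat set set list")
  (objective: "nat set \<Rightarrow> real")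

definition ground :: "smkm_input \<Rightarrow> nat set" where
  "ground I = set (arrivals I)"

definition common_indep :: "smkm_input \<Rightarrow> nat set set" where
  "common_indep I = {S. S \<subseteq> ground I \<and> (\<forall>\<I> \<in> set (matroids I). S \<in> \<I>)}"

definition common_rank :: "smkm_input \<Rightarrow> nat" where
  "common_rank I = Max (card ` common_indep I)"

definition opt_value :: "smkm_input \<Rightarrow> real" where
  "opt_value I = Max (objective I ` common_indep I)"

text \<open>The inputs with \<open>k\<close> matroids and \<open>n\<close> elements whose names are below \<open>m\<close>. An algorithm knows
  \<open>m\<close>, but not which \<open>n\<close> of the \<open>m\<close> names belong to the ground set. For \<open>m = n\<close> no memory at all would be needed, because
  after the last arrival every subset of the ground set can be queried; for unbounded \<open>m\<close> lower
  bounds would hold merely because a name does not fit into the memory.\<close>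

definition smkm_inputs :: "nat \<Rightarrow> nat \<Rightarrow> nat \<Rightarrow> smkm_input set" where
  "smkm_inputs m n k =
     {I. distinct (arrivals I) \<and> length (arrivals I) = n \<and> ground I \<subseteq> {..<m} \<and>
         length (matroids I) = k \<and> (\<forall>\<I> \<in> set (matroids I). is_matroid (ground I) \<I>) \<and>
         (\<forall>S \<subseteq> ground I. 0 \<le> objective I S) \<and> submodular_on (ground I) (objective I)}"

definition partition_card_inputs :: "nat \<Rightarrow> nat \<Rightarrow> nat \<Rightarrow> smkm_input set" where
  "partition_card_inputs m n k =
     {I \<in> smkm_inputs m n k.
         (\<forall>\<I> \<in> set (matroids I). is_partition_matroid (ground I) \<I>) \<and>
         (\<forall>S \<subseteq> ground I. objective I S = real (card S)) \<and>
         common_rank I = k}"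

text \<open>A computation that adaptively queries the common independence oracle and the value oracle of
  the objective function. There is no query about an individual matroid. Between two queries the
  computation is unrestricted.\<close>

datatype 'r oracle_comp =
    Return 'r
  | Ask_Indep "nat set" "bool \<Rightarrow> 'r oracle_comp"
  | Ask_Value "nat set" "real \<Rightarrow> 'r oracle_comp"

primrec run_comp :: "smkm_input \<Rightarrow> 'r oracle_comp \<Rightarrow> 'r" where
  "run_comp I (Return r) = r"
| "run_comp I (Ask_Indep S g) = run_comp I (g (S \<in> common_indep I))"
| "run_comp I (Ask_Value S g) = run_comp I (g (objective I S))"

text \<open>All queries made in the actual execution are about subsets of \<open>V\<close>, where \<open>V\<close> will be the set
  of the elements that have arrived. Since the independence oracle answers ``no'' on names outside
  the ground set, this restriction also prevents a computation from testing whether a name has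
  occurred in the stream.\<close>

primrec queries_within :: "smkm_input \<Rightarrow> nat set \<Rightarrow> 'r oracle_comp \<Rightarrow> bool" where
  "queries_within I V (Return r) \<longleftrightarrow> True"
| "queries_within I V (Ask_Indep S g) \<longleftrightarrow> S \<subseteq> V \<and> queries_within I V (g (S \<in> common_indep I))"
| "queries_within I V (Ask_Value S g) \<longleftrightarrow> S \<subseteq> V \<and> queries_within I V (g (objective I S))"

text \<open>A deterministic single-pass algorithm. The memory content is a bit string; only what is kept
  from one arrival to the next is charged, and the work done within a step is free. A randomized
  algorithm is a probability distribution on deterministic ones, so that its random bits are
  not charged either.\<close>

datatype stream_alg = Stream_Alg
  (initial_memory: "bool list")
  (process: "bool list \<Rightarrow> nat \<Rightarrow> bool list oracle_comp")
  (finish: "bool list \<Rightarrow> nat set oracle_comp")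

primrec memory_after :: "stream_alg \<Rightarrow> smkm_input \<Rightarrow> nat \<Rightarrow> bool list" where
  "memory_after A I 0 = initial_memory A"
| "memory_after A I (Suc i) = run_comp I (process A (memory_after A I i) (arrivals I ! i))"

definition output_set :: "stream_alg \<Rightarrow> smkm_input \<Rightarrow> nat set" where
  "output_set A I = run_comp I (finish A (memory_after A I (length (arrivals I))))"

definition legal_queries :: "stream_alg \<Rightarrow> smkm_input \<Rightarrow> bool" where
  "legal_queries A I \<longleftrightarrow>
     (\<forall>i < length (arrivals I).
        queries_within I (set (take (Suc i) (arrivals I)))
          (process A (memory_after A I i) (arrivals I ! i))) \<and>
     queries_within I (ground I) (finish A (memory_after A I (length (arrivals I))))"

definition memory_within :: "nat \<Rightarrow> stream_alg \<Rightarrow> smkm_input \<Rightarrow> bool" where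
  "memory_within s A I \<longleftrightarrow> (\<forall>i \<le> length (arrivals I). length (memory_after A I i) \<le> s)"

definition streaming_algorithm_for :: "smkm_input set \<Rightarrow> nat \<Rightarrow> stream_alg pmf \<Rightarrow> bool" where
  "streaming_algorithm_for \<C> s R \<longleftrightarrow>
     (\<forall>I \<in> \<C>. \<forall>A \<in> set_pmf R.
        legal_queries A I \<and> memory_within s A I \<and> output_set A I \<in> common_indep I)"

definition has_expected_ratio :: "smkm_input set \<Rightarrow> real \<Rightarrow> stream_alg pmf \<Rightarrow> bool" where
  "has_expected_ratio \<C> \<beta> R \<longleftrightarrow>
     (\<forall>I \<in> \<C>. measure_pmf.expectation R (\<lambda>A. objective I (output_set A I)) \<ge> opt_value I / \<beta>)"

end

theory Submission
  imports Defs
begin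

text \<open>The hard inputs hide a set \<open>H\<close> of \<open>k\<close> elements: the common independent sets are the subsets of
  \<open>H\<close> and the singletons, so an output of size at least 2 must consist of hidden elements. The
  \<open>j\<close>-th arriving element is named \<open>2 * j\<close> or \<open>2 * j + 1\<close> according to a random bit, and the positions
  of the hidden elements form a random \<open>k\<close>-set. Until two hidden elements occur in one query, the
  oracle answers do not depend on \<open>H\<close>. Consider the arrival of the later one of these two. Given the rest
  of the stream, the memory must determine with certainty the name of the earlier one, since a
  query about an element that did not arrive is illegal; but \<open>s\<close> bits of memory determine on
  average at most \<open>s + 2\<close> of the random bits. Hence two hidden elements are found with probability at most
  \<open>k * (k - 1) * (s + 2) / (n - 1)\<close>, whereas the approximation ratio requires a probability of
  order \<open>\<epsilon> / k\<^sup>2\<close>.\<close>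

subsection \<open>Blind runs\<close>

primrec bind_comp :: "'a oracle_comp \<Rightarrow> ('a \<Rightarrow> 'b oracle_comp) \<Rightarrow> 'b oracle_comp" where
  "bind_comp (Return r) f = f r"
| "bind_comp (Ask_Indep S g) f = Ask_Indep S (\<lambda>b. bind_comp (g b) f)"
| "bind_comp (Ask_Value S g) f = Ask_Value S (\<lambda>v. bind_comp (g v) f)"

lemma bind_comp_Return: "bind_comp c Return = c"
  by (induction c) auto

text \<open>The answers of a blind run are those that every hiding input gives as long as no query
  contains two hidden elements.\<close>

primrec blind_run :: "'r oracle_comp \<Rightarrow> 'r" where
  "blind_run (Return r) = r"
| "blind_run (Ask_Indep S g) = blind_run (g (card S \<le> 1))"
| "blind_run (Ask_Value S g) = blind_run (g (real (card S)))"

text \<open>Recording stops at the first query outside \<open>V\<close>: the blind run of an algorithm need not be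
  legal, but on an actual input it is legal until two hidden elements are queried together.\<close>

primrec learned :: "nat set \<Rightarrow> nat set oracle_comp \<Rightarrow> nat set" where
  "learned V (Return r) = (if r \<subseteq> V then r else {})"
| "learned V (Ask_Indep S g) = (if S \<subseteq> V then S \<union> learned V (g (card S \<le> 1)) else {})"
| "learned V (Ask_Value S g) = (if S \<subseteq> V then S \<union> learned V (g (real (card S))) else {})"

lemma learned_subset: "learned V c \<subseteq> V"
  by (induction c) auto

text \<open>The blind answers do not depend on \<open>V\<close>, so both sides come from the same
  sequence of queries; \<open>V\<close> only decides where the recording is cut off.\<close>

lemma learned_chain: "learned V c \<subseteq> learned W c \<or> learned W c \<subseteq> learned V c"
proof (induction c)
  case (Ask_Indep S g)
  have "learned V (g b) \<subseteq> learned W (g b) \<or> learned W (g b) \<subseteq> learned V (g b)" for b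
    by (rule Ask_Indep) simp
  then show ?case by (smt (verit) Un_mono learned.simps(2) empty_subsetI subset_refl)
next
  case (Ask_Value S g)
  have "learned V (g b) \<subseteq> learned W (g b) \<or> learned W (g b) \<subseteq> learned V (g b)" for b
    by (rule Ask_Value) simp
  then show ?case by (smt (verit) Un_mono learned.simps(3) empty_subsetI subset_refl)
qed auto

definition hides :: "smkm_input \<Rightarrow> nat set \<Rightarrow> bool" where
  "hides I H \<longleftrightarrow> (\<forall>S \<subseteq> ground I. (S \<in> common_indep I \<longleftrightarrow> card S \<le> 1 \<or> S \<subseteq> H) \<and>
     objective I S = real (card S))"

text \<open>The first true answer that differs from the blind one belongs to a query inside
  \<open>H\<close> with at least two elements. All earlier queries were legal, hence inside the
  ground set, so this query is still recorded. The quantifier over \<open>f\<close> allows whatever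
  runs after \<open>c\<close> to be appended.\<close>

lemma blind_or_detected:
  assumes "hides I H" "V \<subseteq> ground I" "queries_within I V c"
  shows "(run_comp I c = blind_run c \<and>
            (\<forall>f. learned (ground I) (f (blind_run c)) \<subseteq> learned (ground I) (bind_comp c f))) \<or>
         (\<exists>S. S \<subseteq> H \<and> S \<subseteq> V \<and> 2 \<le> card S \<and> (\<forall>f. S \<subseteq> learned (ground I) (bind_comp c f)))"
  using assms(3)
proof (induction c)
  case (Return r)
  then show ?case by simp
next
  case (Ask_Indep S g)
  from Ask_Indep.prems have S: "S \<subseteq> V" and q: "queries_within I V (g (S \<in> common_indep I))"
    by auto
  from S assms have SG: "S \<subseteq> ground I" by blast
  show ?case
  proof (cases "(S \<in> common_indep I) = (card S \<le> 1)")
    case True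
    have "(run_comp I (g (card S \<le> 1)) = blind_run (g (card S \<le> 1)) \<and>
            (\<forall>f. learned (ground I) (f (blind_run (g (card S \<le> 1))))
                 \<subseteq> learned (ground I) (bind_comp (g (card S \<le> 1)) f))) \<or>
         (\<exists>S'. S' \<subseteq> H \<and> S' \<subseteq> V \<and> 2 \<le> card S' \<and>
            (\<forall>f. S' \<subseteq> learned (ground I) (bind_comp (g (card S \<le> 1)) f)))"
      by (rule Ask_Indep.IH) (use q True in auto)
    then show ?thesis using True SG by (simp add: le_supI2) blast
  next
    case False
    then have "S \<subseteq> H" "2 \<le> card S" using assms(1) SG unfolding hides_def by auto
    then show ?thesis using S SG by (intro disjI2 exI[of _ S]) auto
  qed
next
  case (Ask_Value S g)
  from Ask_Value.prems have S: "S \<subseteq> V" and q: "queries_within I V (g (objective I S))"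
    by auto
  from S assms have SG: "S \<subseteq> ground I" by blast
  then have v: "objective I S = real (card S)" using assms(1) unfolding hides_def by auto
  have "(run_comp I (g (card S)) = blind_run (g (card S)) \<and>
          (\<forall>f. learned (ground I) (f (blind_run (g (card S))))
               \<subseteq> learned (ground I) (bind_comp (g (card S)) f))) \<or>
       (\<exists>S'. S' \<subseteq> H \<and> S' \<subseteq> V \<and> 2 \<le> card S' \<and>
          (\<forall>f. S' \<subseteq> learned (ground I) (bind_comp (g (card S)) f)))"
    by (rule Ask_Value.IH) (use q v in auto)
  then show ?case using v SG by (simp add: le_supI2) blast
qed

section \<open>Detection of hidden pairs along the stream\<close>

definition blind_memory :: "stream_alg \<Rightarrow> nat list \<Rightarrow> bool list" where
  "blind_memory A xs = foldl (\<lambda>M x. blind_run (process A M x)) (initial_memory A) xs"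

primrec continuation :: "stream_alg \<Rightarrow> nat list \<Rightarrow> bool list \<Rightarrow> nat set oracle_comp" where
  "continuation A [] M = finish A M"
| "continuation A (x # xs) M = bind_comp (process A M x) (continuation A xs)"

text \<open>The elements before position \<open>q\<close> enter only through the memory and through
  the cut-off \<open>set xs\<close>; this makes counting over the earlier bits possible.\<close>

definition remembered :: "stream_alg \<Rightarrow> nat list \<Rightarrow> nat \<Rightarrow> nat set" where
  "remembered A xs q =
     learned (set xs) (continuation A (drop q xs) (blind_memory A (take q xs)))"

lemma positions_of_pair:
  assumes "S \<subseteq> set (take i xs)" "2 \<le> card S"
  obtains p q where "p < q" "q < i" "q < length xs" "xs ! p \<in> S" "xs ! q \<in> S"
proof -
  obtain x y where xy: "x \<in> S" "y \<in> S" "x \<noteq> y"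
    using assms(2) by (metis One_nat_def card.empty card_le_Suc0_iff_eq card.infinite
        not_less_eq_eq numeral_2_eq_2 zero_le)
  have "\<exists>p<i. p < length xs \<and> xs ! p = z" if "z \<in> S" for z
    using that assms(1) by (force simp: subset_iff in_set_conv_nth)
  then obtain p q where "p < i" "p < length xs" "xs ! p = x" "q < i" "q < length xs" "xs ! q = y"
    using xy by metis
  with xy show ?thesis using that[of p q] that[of q p] by (cases p q rule: linorder_cases) auto
qed

text \<open>Two hidden elements queried together at step \<open>i\<close> have both arrived by then. When the
  later of them arrived, the memory determined the earlier one, given the elements still to come.\<close>

lemma remembered_if_detected:
  assumes hides: "hides I H" and legal: "legal_queries A I" and mem: "memory_within s A I"
    and out: "output_set A I \<subseteq> H" "output_set A I \<subseteq> ground I" "2 \<le> card (output_set A I)"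
  defines "xs \<equiv> arrivals I"
  shows "\<exists>p q. p < q \<and> q < length xs \<and> xs ! p \<in> H \<and> xs ! q \<in> H \<and>
           xs ! p \<in> remembered A xs q \<and> length (blind_memory A (take q xs)) \<le> s"
proof (rule ccontr)
  let ?n = "length xs"
  let ?K = "remembered A xs"
  assume none: "\<not> ?thesis"
  have G: "ground I = set xs" by (simp add: ground_def xs_def)
  \<comment> \<open>When step \<open>i\<close> makes its queries, the entries at positions up to
    \<open>i\<close> have arrived, so \<open>q \<le> i\<close> and the invariant carries
    \<open>S\<close> from \<open>i\<close> back to \<open>q\<close>. The case \<open>i = ?n\<close>
    is the output step.\<close>
  have false: False
    if inv: "\<forall>j\<le>i. memory_after A I j = blind_memory A (take j xs) \<and> ?K i \<subseteq> ?K j"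
      and "i \<le> ?n" and S: "S \<subseteq> H" "S \<subseteq> set (take (Suc i) xs)" "2 \<le> card S" "S \<subseteq> ?K i" for i S
  proof -
    obtain p q where pq: "p < q" "q < Suc i" "q < ?n" "xs ! p \<in> S" "xs ! q \<in> S"
      using positions_of_pair[OF S(2,3)] by metis
    from pq(2) inv have "memory_after A I q = blind_memory A (take q xs)" "?K i \<subseteq> ?K q" by auto
    moreover from this have "length (blind_memory A (take q xs)) \<le> s"
      using mem pq(3) unfolding memory_within_def xs_def by (metis less_imp_le)
    ultimately show False using none pq S by blast
  qed
  \<comment> \<open>Since \<open>none\<close> excludes a queried hidden pair, every step behaves
    blindly, and the remembered sets can only shrink as the stream advances.\<close>
  have inv: "\<forall>j\<le>i. memory_after A I j = blind_memory A (take j xs) \<and> ?K i \<subseteq> ?K j"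
    if "i \<le> ?n" for i
    using that
  proof (induction i)
    case 0
    then show ?case by (simp add: blind_memory_def)
  next
    case (Suc i)
    then have i: "i < ?n" and IH: "\<forall>j\<le>i. memory_after A I j = blind_memory A (take j xs) \<and> ?K i \<subseteq> ?K j"
      by auto
    define M where "M = blind_memory A (take i xs)"
    define c where "c = process A M (xs ! i)"
    have M: "memory_after A I i = M" using IH by (simp add: M_def)
    have M': "blind_memory A (take (Suc i) xs) = blind_run c"
      using i by (simp add: take_Suc_conv_app_nth blind_memory_def M_def c_def)
    have Ki: "?K i = learned (ground I) (bind_comp c (continuation A (drop (Suc i) xs)))"
      using i by (simp add: remembered_def G c_def M_def Cons_nth_drop_Suc[symmetric])
    have KS: "?K (Suc i) = learned (ground I) (continuation A (drop (Suc i) xs) (blind_run c))"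
      by (simp add: remembered_def G M')
    have "queries_within I (set (take (Suc i) xs)) c"
      using legal i M unfolding legal_queries_def c_def xs_def by auto
    moreover have "set (take (Suc i) xs) \<subseteq> ground I" by (simp add: G set_take_subset)
    ultimately have "run_comp I c = blind_run c \<and> ?K (Suc i) \<subseteq> ?K i"
      using blind_or_detected[OF hides, of "set (take (Suc i) xs)" c] false[OF IH] i
      unfolding Ki KS by (meson less_imp_le)
    moreover have "memory_after A I (Suc i) = run_comp I c"
      by (simp add: M c_def xs_def)
    ultimately show ?case using IH M' by (metis le_Suc_eq order_refl subset_trans)
  qed
  define c where "c = finish A (blind_memory A (take ?n xs))"
  have m: "memory_after A I ?n = blind_memory A xs" using inv[of ?n] by simp
  have K: "?K ?n = learned (ground I) c" by (simp add: remembered_def G c_def)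
  have "queries_within I (ground I) c"
    using legal m unfolding legal_queries_def c_def xs_def by simp
  from blind_or_detected[OF hides order_refl this]
  show False
  proof
    assume *: "run_comp I c = blind_run c \<and>
            (\<forall>f. learned (ground I) (f (blind_run c)) \<subseteq> learned (ground I) (bind_comp c f))"
    then have o: "output_set A I = blind_run c"
      using m by (simp add: output_set_def c_def xs_def)
    \<comment> \<open>With \<open>f = Return\<close> the output itself is among the recorded
      elements, so an output of two hidden elements counts as a detected pair.\<close>
    have "learned (ground I) (Return (blind_run c)) \<subseteq> learned (ground I) (bind_comp c Return)"
      using * by blast
    then have "output_set A I \<subseteq> ?K ?n"
      using out(2) by (simp add: o K bind_comp_Return)
    then show False using false[OF inv[of ?n], of "output_set A I"] out by (simp add: G)
  next
    assume "\<exists>S. S \<subseteq> H \<and> S \<subseteq> ground I \<and> 2 \<le> card S \<and> (\<forall>f. S \<subseteq> learned (ground I) (bind_comp c f))"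
    then obtain S where S: "S \<subseteq> H" "S \<subseteq> ground I" "2 \<le> card S"
        "S \<subseteq> learned (ground I) (bind_comp c Return)" by blast
    then show False using false[OF inv[of ?n], of S] by (simp add: G K bind_comp_Return)
  qed
qed

subsection \<open>Counting streams\<close>

definition stream_name :: "nat set \<Rightarrow> nat \<Rightarrow> nat" where
  "stream_name B j = 2 * j + of_bool (j \<in> B)"

definition stream_of :: "nat \<Rightarrow> nat set \<Rightarrow> nat list" where
  "stream_of n B = map (stream_name B) [0..<n]"

lemma stream_name_eq_iff: "stream_name B i = stream_name C j \<longleftrightarrow> i = j \<and> (i \<in> B \<longleftrightarrow> j \<in> C)"
  unfolding stream_name_def by (cases "i \<in> B"; cases "j \<in> C"; simp; presburger)

lemma inj_stream_name: "inj (stream_name B)"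
  by (rule injI) (simp add: stream_name_eq_iff)

lemma stream_name_less: "j < n \<Longrightarrow> stream_name B j < 2 * n"
  by (cases "j \<in> B") (auto simp: stream_name_def)

lemma set_stream_of: "set (stream_of n B) = stream_name B ` {..<n}"
  by (simp add: stream_of_def lessThan_atLeast0)

lemma stream_name_in_stream_iff:
  "stream_name B j \<in> set (stream_of n C) \<longleftrightarrow> j < n \<and> (j \<in> B \<longleftrightarrow> j \<in> C)"
  by (auto simp: set_stream_of stream_name_eq_iff image_iff)

text \<open>The learned sets form a chain, so the smallest of those with at least \<open>t\<close> elements
  is contained in the others: at least \<open>t\<close> of the bits are common to all these streams.\<close>

lemma card_learned_ge:
  fixes c :: "nat set oracle_comp" and n q :: nat
  defines "K B \<equiv> {p. p < q \<and> stream_name B p \<in> learned (set (stream_of n B)) c}"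
  assumes X: "X \<subseteq> Pow {..<n}" and fix_bits: "\<forall>B\<in>X. B \<inter> {q..<n} = Z" and "q \<le> n"
  shows "card {B \<in> X. t \<le> card (K B)} * 2 ^ t \<le> 2 ^ q"
proof (cases "{B \<in> X. t \<le> card (K B)} = {}")
  case True
  then show ?thesis by (simp only: card.empty mult_zero_left zero_le)
next
  case False
  let ?Y = "{B \<in> X. t \<le> card (K B)}"
  have finY: "finite ?Y" by (rule finite_subset[of _ "Pow {..<n}"]) (use X in auto)
  have finK: "finite (K B)" and Ksub: "K B \<subseteq> {..<q}" for B unfolding K_def by auto
  obtain B0 where B0: "B0 \<in> ?Y" and min: "\<And>B. B \<in> ?Y \<Longrightarrow> card (K B0) \<le> card (K B)"
    using False ex_has_least_nat[of "\<lambda>B. B \<in> ?Y" _ "\<lambda>B. card (K B)"] by blast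
  \<comment> \<open>The recorded name lies in the stream of \<open>C\<close> too, and a stream has
    only one of the two names of a position, so the bits of \<open>B\<close> and \<open>C\<close>
    agree there.\<close>
  have transfer: "p \<in> K C \<and> (p \<in> B \<longleftrightarrow> p \<in> C)"
    if "learned (set (stream_of n B)) c \<subseteq> learned (set (stream_of n C)) c" "p \<in> K B" for B C p
  proof -
    have "p < q" and p: "stream_name B p \<in> learned (set (stream_of n C)) c"
      using that unfolding K_def by auto
    then have "stream_name B p \<in> set (stream_of n C)" using learned_subset by blast
    then have "p \<in> B \<longleftrightarrow> p \<in> C" by (simp add: stream_name_in_stream_iff)
    moreover from this have "stream_name B p = stream_name C p" by (simp add: stream_name_eq_iff)
    ultimately show ?thesis using p \<open>p < q\<close> unfolding K_def by simp
  qed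
  have agree: "p \<in> B \<longleftrightarrow> p \<in> B0" if B: "B \<in> ?Y" and p: "p \<in> K B0" for B p
  proof (cases "learned (set (stream_of n B0)) c \<subseteq> learned (set (stream_of n B)) c")
    case True
    then show ?thesis using transfer p by blast
  next
    case False
    then have sub: "learned (set (stream_of n B)) c \<subseteq> learned (set (stream_of n B0)) c"
      using learned_chain by blast
    \<comment> \<open>Minimality of \<open>K B0\<close> turns this inclusion into an
      equality.\<close>
    then have "K B \<subseteq> K B0" using transfer by blast
    then have "K B = K B0" using min[OF B] finK card_seteq by blast
    then show ?thesis using transfer[OF sub] p by blast
  qed
  \<comment> \<open>A member of \<open>?Y\<close> is determined by its bits below \<open>q\<close>
    outside \<open>K B0\<close>: those in \<open>K B0\<close> agree with \<open>B0\<close>, and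
    those from \<open>q\<close> on are fixed by \<open>Z\<close>.\<close>
  have "inj_on (\<lambda>B. B \<inter> ({..<q} - K B0)) ?Y"
  proof (rule inj_onI)
    fix B C assume B: "B \<in> ?Y" and C: "C \<in> ?Y"
      and eq: "B \<inter> ({..<q} - K B0) = C \<inter> ({..<q} - K B0)"
    have "p \<in> B \<longleftrightarrow> p \<in> C" for p
    proof (cases "p \<in> K B0")
      case True then show ?thesis using agree B C by blast
    next
      case False
      have "p \<in> B \<inter> {q..<n} \<longleftrightarrow> p \<in> C \<inter> {q..<n}" using B C fix_bits by blast
      moreover have "p \<in> B \<longrightarrow> p < n" "p \<in> C \<longrightarrow> p < n" using B C X by auto
      ultimately show ?thesis using eq False by (cases "p < q") auto
    qed
    then show "B = C" by blast
  qed
  then have "card ?Y \<le> card (Pow ({..<q} - K B0))"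
    by (rule card_inj_on_le) auto
  also have "\<dots> = 2 ^ (q - card (K B0))"
    using finK Ksub by (simp add: card_Pow card_Diff_subset)
  finally have "card ?Y * 2 ^ t \<le> 2 ^ (q - card (K B0)) * 2 ^ t" by simp
  also have "\<dots> \<le> 2 ^ (q - card (K B0)) * 2 ^ card (K B0)" using B0 by simp
  also have "\<dots> = 2 ^ q"
    using card_mono[OF _ Ksub[of B0]] by (simp flip: power_add)
  finally show ?thesis .
qed

text \<open>The memory bound is assumed only for actual runs, so a blind run may exceed
  \<open>s\<close> bits. Counting no position in that case leaves finitely many memory contents to
  consider.\<close>

definition known_positions :: "stream_alg \<Rightarrow> nat \<Rightarrow> nat \<Rightarrow> nat set \<Rightarrow> nat \<Rightarrow> nat set" where
  "known_positions A s n B q =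
     {p. p < q \<and> stream_name B p \<in> remembered A (stream_of n B) q \<and>
         length (blind_memory A (take q (stream_of n B))) \<le> s}"

lemma card_bit_strings_le: "card {M :: bool list. length M \<le> s} \<le> 2 ^ Suc s"
proof -
  have "card {M :: bool list. length M \<le> s} = (\<Sum>i\<le>s. 2 ^ i)"
    using card_lists_length_le[of "UNIV :: bool set" s] by simp
  also have "\<dots> \<le> 2 ^ Suc s" by (induction s) auto
  finally show ?thesis .
qed

lemma finite_bit_strings: "finite {M :: bool list. length M \<le> s}"
  using finite_lists_length_le[of "UNIV :: bool set" s] by simp

text \<open>Once the memory at \<open>q\<close> and the bits from \<open>q\<close> on are fixed, the
  continuation is a single computation and \<open>card_learned_ge\<close> applies. There are at most
  \<open>2 ^ Suc s\<close> memories and \<open>2 ^ (n - q)\<close> futures, each pair contributing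
  at most \<open>2 ^ q / 2 ^ t\<close>.\<close>

lemma card_known_positions_ge:
  assumes q: "q \<le> n"
  shows "card {B \<in> Pow {..<n}. t \<le> card (known_positions A s n B q)} * 2 ^ t \<le> 2 ^ Suc s * 2 ^ n"
\<comment> \<open>For \<open>t = 0\<close> the count also includes bit sets whose memory is too
  long, which the cover used below would miss.\<close>
proof (cases "t = 0")
  case True
  then have "card {B \<in> Pow {..<n}. t \<le> card (known_positions A s n B q)} * 2 ^ t = 1 * 2 ^ n"
    by (simp add: card_Pow flip: Pow_def)
  also have "\<dots> \<le> 2 ^ Suc s * 2 ^ n" by (intro mult_right_mono) auto
  finally show ?thesis .
next
  case t: False
  let ?Mem = "{M :: bool list. length M \<le> s}"
  let ?mem = "\<lambda>B. blind_memory A (take q (stream_of n B))"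
  let ?c = "\<lambda>M Z. continuation A (map (stream_name Z) [q..<n]) M"
  let ?X = "\<lambda>Z. {B \<in> Pow {..<n}. B \<inter> {q..<n} = Z}"
  let ?Y = "\<lambda>M Z. {B \<in> ?X Z. t \<le> card {p. p < q \<and>
                stream_name B p \<in> learned (set (stream_of n B)) (?c M Z)}}"
  have sub: "{B \<in> Pow {..<n}. t \<le> card (known_positions A s n B q)}
       \<subseteq> (\<Union>MZ \<in> ?Mem \<times> Pow {q..<n}. ?Y (fst MZ) (snd MZ))"
  proof
    fix B assume B: "B \<in> {B \<in> Pow {..<n}. t \<le> card (known_positions A s n B q)}"
    let ?Z = "B \<inter> {q..<n}"
    have d: "drop q (stream_of n B) = map (stream_name ?Z) [q..<n]"
      by (auto simp: stream_of_def drop_map stream_name_def)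
    have "known_positions A s n B q \<noteq> {}" using B t by auto
    then have len: "length (?mem B) \<le> s" unfolding known_positions_def by blast
    then have "known_positions A s n B q =
        {p. p < q \<and> stream_name B p \<in> learned (set (stream_of n B)) (?c (?mem B) ?Z)}"
      unfolding known_positions_def remembered_def d by simp
    then have "B \<in> ?Y (?mem B) ?Z" using B by simp
    then show "B \<in> (\<Union>MZ \<in> ?Mem \<times> Pow {q..<n}. ?Y (fst MZ) (snd MZ))"
      using len by (intro UN_I[of "(?mem B, ?Z)"]) auto
  qed
  have fin: "finite (\<Union>MZ \<in> ?Mem \<times> Pow {q..<n}. ?Y (fst MZ) (snd MZ))"
    by (rule finite_subset[of _ "Pow {..<n}"]) auto
  have "card {B \<in> Pow {..<n}. t \<le> card (known_positions A s n B q)} * 2 ^ t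
      \<le> (\<Sum>MZ \<in> ?Mem \<times> Pow {q..<n}. card (?Y (fst MZ) (snd MZ))) * 2 ^ t"
    using card_mono[OF fin sub] card_UN_le[of "?Mem \<times> Pow {q..<n}" "\<lambda>MZ. ?Y (fst MZ) (snd MZ)"]
      finite_bit_strings[of s] by (intro mult_right_mono) auto
  also have "\<dots> = (\<Sum>MZ \<in> ?Mem \<times> Pow {q..<n}. card (?Y (fst MZ) (snd MZ)) * 2 ^ t)"
    by (simp add: sum_distrib_right)
  also have "\<dots> \<le> (\<Sum>MZ \<in> ?Mem \<times> Pow {q..<n}. 2 ^ q)"
    by (intro sum_mono card_learned_ge) (use q in auto)
  also have "\<dots> = card ?Mem * 2 ^ (n - q) * 2 ^ q"
    by (simp add: card_cartesian_product card_Pow)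
  also have "\<dots> = card ?Mem * 2 ^ n"
    using q by (simp add: mult.assoc flip: power_add)
  also have "\<dots> \<le> 2 ^ Suc s * 2 ^ n"
    using card_bit_strings_le by (rule mult_right_mono) simp
  finally show ?thesis .
qed

text \<open>The average is at most \<open>r\<close> plus the tail probabilities beyond
  \<open>r\<close>, which are bounded by 1/2, 1/4, ... and add up to at most 1.\<close>

lemma sum_le_of_geometric_tail:
  fixes g :: "'a \<Rightarrow> nat"
  assumes "finite X" and tail: "\<And>t. card {x \<in> X. t \<le> g x} * 2 ^ t \<le> 2 ^ r * card X"
  shows "(\<Sum>x\<in>X. g x) \<le> (r + 1) * card X"
proof -
  obtain N where N: "\<And>x. x \<in> X \<Longrightarrow> g x \<le> N"
    using finite_nat_set_iff_bounded_le[of "g ` X"] assms(1) by auto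
  have tail': "real (card {x \<in> X. r + Suc i \<le> g x}) \<le> (1 / 2) ^ Suc i * card X" for i
  proof -
    have "real (card {x \<in> X. r + Suc i \<le> g x} * 2 ^ (r + Suc i)) \<le> real (2 ^ r * card X)"
      using tail[of "r + Suc i"] by (rule of_nat_mono)
    then have "2 ^ r * (real (card {x \<in> X. r + Suc i \<le> g x}) * 2 ^ Suc i) \<le> 2 ^ r * real (card X)"
      unfolding power_add by (simp only: of_nat_mult of_nat_power of_nat_numeral mult_ac)
    then have "real (card {x \<in> X. r + Suc i \<le> g x}) * 2 ^ Suc i \<le> card X"
      by (rule mult_left_le_imp_le) simp
    then show ?thesis by (simp add: power_one_over field_simps)
  qed
  have "g x \<le> r + (\<Sum>i<N. of_bool (r + Suc i \<le> g x))" if "x \<in> X" for x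
  proof -
    have "{..<g x - r} \<subseteq> {i \<in> {..<N}. r + Suc i \<le> g x}" using N[OF that] by auto
    then have "g x - r \<le> card {i \<in> {..<N}. r + Suc i \<le> g x}"
      using card_mono[of "{i \<in> {..<N}. r + Suc i \<le> g x}" "{..<g x - r}"] by simp
    also have "\<dots> = (\<Sum>i<N. of_bool (r + Suc i \<le> g x))"
      by (simp add: of_bool_def flip: sum.inter_filter)
    finally show ?thesis by simp
  qed
  then have "(\<Sum>x\<in>X. g x) \<le> (\<Sum>x\<in>X. r + (\<Sum>i<N. of_bool (r + Suc i \<le> g x)))"
    by (rule sum_mono)
  also have "\<dots> = r * card X + (\<Sum>i<N. \<Sum>x\<in>X. of_bool (r + Suc i \<le> g x))"
    unfolding sum.distrib by (subst (2) sum.swap) simp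
  also have "\<dots> = r * card X + (\<Sum>i<N. card {x \<in> X. r + Suc i \<le> g x})"
    using assms(1) by (simp add: of_bool_def flip: sum.inter_filter)
  also have "\<dots> \<le> r * card X + card X"
  proof -
    have "real (\<Sum>i<N. card {x \<in> X. r + Suc i \<le> g x}) \<le> (\<Sum>i<N. (1 / 2) ^ Suc i * card X)"
      unfolding of_nat_sum by (intro sum_mono tail')
    also have "\<dots> = (\<Sum>i<N. (1 / 2) ^ Suc i) * card X" by (simp add: sum_distrib_right)
    also have "(\<Sum>i<N. (1 / 2 :: real) ^ Suc i) = 1 - (1 / 2) ^ N"
      by (induction N) (auto simp: field_simps)
    also have "(1 - (1 / 2) ^ N) * real (card X) \<le> 1 * real (card X)"
      by (intro mult_right_mono) auto
    finally show ?thesis by linarith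
  qed
  finally show ?thesis by simp
qed

text \<open>The tail bound has \<open>r = Suc s\<close>, and the excess over \<open>r\<close>
  averages at most 1; hence \<open>s + 2\<close>.\<close>

lemma sum_card_known_positions_le:
  assumes "q \<le> n"
  shows "(\<Sum>B\<in>Pow {..<n}. card (known_positions A s n B q)) \<le> (s + 2) * 2 ^ n"
  using sum_le_of_geometric_tail[of "Pow {..<n}" "\<lambda>B. card (known_positions A s n B q)" "Suc s"]
    card_known_positions_ge[OF assms] by (simp add: card_Pow)

section \<open>Pairs of positions in random k-sets\<close>

lemma card_subsets_containing_pair:
  assumes "finite N" "p \<in> N" "q \<in> N" "p \<noteq> q" "2 \<le> k"
  shows "card {P. P \<subseteq> N \<and> card P = k \<and> p \<in> P \<and> q \<in> P} = (card N - 2) choose (k - 2)"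
proof -
  let ?R = "{P. P \<subseteq> N - {p, q} \<and> card P = k - 2}"
  have "bij_betw (\<lambda>P. P \<union> {p, q}) ?R {P. P \<subseteq> N \<and> card P = k \<and> p \<in> P \<and> q \<in> P}"
  proof (rule bij_betw_byWitness[where f' = "\<lambda>P. P - {p, q}"])
    show "(\<lambda>P. P \<union> {p, q}) ` ?R \<subseteq> {P. P \<subseteq> N \<and> card P = k \<and> p \<in> P \<and> q \<in> P}"
    proof (rule image_subsetI)
      fix P assume "P \<in> ?R"
      then have P: "P \<subseteq> N - {p, q}" "card P = k - 2" by auto
      have "finite P" using P(1) assms(1) by (meson finite_Diff finite_subset)
      then have "card (insert p (insert q P)) = Suc (Suc (card P))"
        using P(1) assms(4) by (subst card_insert_disjoint; auto)+
      then show "P \<union> {p, q} \<in> {P. P \<subseteq> N \<and> card P = k \<and> p \<in> P \<and> q \<in> P}"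
        using P assms by auto
    qed
    show "(\<lambda>P. P - {p, q}) ` {P. P \<subseteq> N \<and> card P = k \<and> p \<in> P \<and> q \<in> P} \<subseteq> ?R"
      using assms by (auto simp: card_Diff_subset)
  qed auto
  then have "card {P. P \<subseteq> N \<and> card P = k \<and> p \<in> P \<and> q \<in> P} = card ?R"
    by (simp add: bij_betw_same_card)
  also have "\<dots> = (card N - 2) choose (k - 2)"
    using assms by (subst n_subsets) (auto simp: card_Diff_subset numeral_2_eq_2)
  finally show ?thesis .
qed

text \<open>Both sides count \<open>k\<close>-subsets of an \<open>n\<close>-set with an ordered
  pair of distinct members marked. As a quotient of binomials this gives the probability that a
  random \<open>k\<close>-set contains two given positions.\<close>

lemma binomial_minus_two:
  assumes "2 \<le> k" "k \<le> n"
  shows "n * (n - 1) * ((n - 2) choose (k - 2)) = k * (k - 1) * (n choose k)"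
proof -
  obtain k' n' where k: "k = Suc (Suc k')" and n: "n = Suc (Suc n')"
    using assms by (metis Suc_le_D le_trans numeral_2_eq_2 Suc_le_mono)
  have "n * (n - 1) * ((n - 2) choose (k - 2)) = Suc (Suc n') * (Suc n' * (n' choose k'))"
    by (simp only: k n diff_Suc_Suc diff_Suc_1 numeral_2_eq_2 minus_nat.diff_0 mult.assoc)
  also have "\<dots> = Suc k' * (Suc (Suc n') * (Suc n' choose Suc k'))"
    by (simp only: Suc_times_binomial[symmetric] mult.left_commute)
  also have "\<dots> = k * (k - 1) * (n choose k)"
    unfolding Suc_times_binomial[of "Suc k'" "Suc n'", symmetric] k n
    by (simp only: diff_Suc_1 mult.assoc mult.left_commute)
  finally show ?thesis .
qed

text \<open>Union bound over pairs: a position \<open>p\<close> known at \<open>q\<close> affects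
  only the \<open>k\<close>-sets that contain both. Known positions lie below \<open>q\<close>, so
  the two are distinct.\<close>

lemma card_detected_le:
  assumes "2 \<le> k" "k \<le> n"
  shows "card {(B, P). B \<subseteq> {..<n} \<and> P \<subseteq> {..<n} \<and> card P = k \<and>
             (\<exists>q\<in>P. \<exists>p\<in>P. p \<in> known_positions A s n B q)}
       \<le> n * ((s + 2) * 2 ^ n) * ((n - 2) choose (k - 2))"
proof -
  let ?b = "(n - 2) choose (k - 2)"
  let ?K = "known_positions A s n"
  let ?W = "\<lambda>B. \<Union>q\<in>{..<n}. \<Union>p\<in>?K B q. {P. P \<subseteq> {..<n} \<and> card P = k \<and> p \<in> P \<and> q \<in> P}"
  have W: "card (?W B) \<le> (\<Sum>q<n. card (?K B q) * ?b)" for B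
  proof -
    have "card (\<Union>p\<in>?K B q. {P. P \<subseteq> {..<n} \<and> card P = k \<and> p \<in> P \<and> q \<in> P}) \<le> card (?K B q) * ?b"
      if "q < n" for q
    proof -
      have "finite (?K B q)" unfolding known_positions_def by simp
      then have "card (\<Union>p\<in>?K B q. {P. P \<subseteq> {..<n} \<and> card P = k \<and> p \<in> P \<and> q \<in> P})
          \<le> (\<Sum>p\<in>?K B q. card {P. P \<subseteq> {..<n} \<and> card P = k \<and> p \<in> P \<and> q \<in> P})"
        by (rule card_UN_le)
      also have "\<dots> = (\<Sum>p\<in>?K B q. ?b)"
        by (intro sum.cong refl)
          (use that assms in \<open>auto simp: known_positions_def card_subsets_containing_pair\<close>)
      finally show ?thesis by simp
    qed
    then show ?thesis by (intro order_trans[OF card_UN_le[OF finite_lessThan]] sum_mono) simp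
  qed
  have "{(B, P). B \<subseteq> {..<n} \<and> P \<subseteq> {..<n} \<and> card P = k \<and>
             (\<exists>q\<in>P. \<exists>p\<in>P. p \<in> ?K B q)} \<subseteq> (SIGMA B:Pow {..<n}. ?W B)" by auto
  moreover have finW: "finite (?W B)" for B by (rule finite_subset[of _ "Pow {..<n}"]) auto
  ultimately have "card {(B, P). B \<subseteq> {..<n} \<and> P \<subseteq> {..<n} \<and> card P = k \<and>
             (\<exists>q\<in>P. \<exists>p\<in>P. p \<in> ?K B q)} \<le> card (SIGMA B:Pow {..<n}. ?W B)"
    by (intro card_mono finite_SigmaI) auto
  also have "\<dots> = (\<Sum>B\<in>Pow {..<n}. card (?W B))" using finW by (subst card_SigmaI) auto
  also have "\<dots> \<le> (\<Sum>B\<in>Pow {..<n}. \<Sum>q<n. card (?K B q) * ?b)" by (intro sum_mono W)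
  also have "\<dots> = (\<Sum>q<n. (\<Sum>B\<in>Pow {..<n}. card (?K B q)) * ?b)"
    by (subst sum.swap) (simp add: sum_distrib_right)
  also have "\<dots> \<le> (\<Sum>q<n. ((s + 2) * 2 ^ n) * ?b)"
    by (intro sum_mono mult_right_mono sum_card_known_positions_le) auto
  finally show ?thesis by (simp add: mult_ac)
qed

subsection \<open>Hard inputs\<close>

text \<open>Augmentation is a pigeonhole over the blocks: the larger set has more elements in some
  block, and adding one of them respects the capacity there.\<close>

lemma partition_matroid_is_matroid:
  assumes "is_partition_matroid N \<I>"
  shows "is_matroid N \<I>"
proof -
  obtain P d where N: "finite N" and P: "partition_on N P"
    and I: "\<I> = {S. S \<subseteq> N \<and> (\<forall>B \<in> P. card (S \<inter> B) \<le> d B)}"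
    using assms unfolding is_partition_matroid_def by blast
  have finP: "finite P" using P N by (rule finite_elements[rotated])
  have BN: "B \<subseteq> N" if "B \<in> P" for B using P that by (auto simp: partition_on_def)
  have disj: "B \<inter> C = {}" if "B \<in> P" "C \<in> P" "B \<noteq> C" for B C
    using P that by (auto simp: partition_on_def disjoint_def)
  have card_blocks: "card S = (\<Sum>B\<in>P. card (S \<inter> B))" if "S \<subseteq> N" for S
  proof -
    have "S = (\<Union>B\<in>P. S \<inter> B)" using that P by (auto simp: partition_on_def)
    moreover have "card (\<Union>B\<in>P. S \<inter> B) = (\<Sum>B\<in>P. card (S \<inter> B))"
      by (rule card_UN_disjoint[OF finP])
        (use that N finite_subset disj in \<open>blast+\<close>)
    ultimately show ?thesis by simp
  qed
  have down: "S \<in> \<I>" if "T \<in> \<I>" "S \<subseteq> T" for S T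
  proof -
    have "card (S \<inter> B) \<le> card (T \<inter> B)" for B
      using that N unfolding I by (intro card_mono) (auto intro: finite_subset)
    then show ?thesis using that unfolding I by (blast intro: order_trans)
  qed
  have augment: "\<exists>x \<in> T - S. insert x S \<in> \<I>" if S: "S \<in> \<I>" and T: "T \<in> \<I>" and less: "card S < card T" for S T
  proof -
    have SN: "S \<subseteq> N" and TN: "T \<subseteq> N" using S T I by auto
    have finS: "finite S" using SN N finite_subset by blast
    obtain B where B: "B \<in> P" "card (S \<inter> B) < card (T \<inter> B)"
      using less card_blocks[OF SN] card_blocks[OF TN] by (metis not_less sum_mono)
    then obtain x where x: "x \<in> T \<inter> B" "x \<notin> S \<inter> B"
      using finS by (metis card_mono finite_Int not_less subsetI)
    have "card (insert x S \<inter> C) \<le> d C" if C: "C \<in> P" for C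
    proof (cases "C = B")
      case True
      have "card (insert x S \<inter> C) \<le> Suc (card (S \<inter> B))"
        using x finS True by (simp add: card_insert_if)
      also have "\<dots> \<le> card (T \<inter> B)" using B by simp
      also have "\<dots> \<le> d B" using T B I by auto
      finally show ?thesis using True by simp
    next
      case False
      then have "insert x S \<inter> C = S \<inter> C" using disj[OF C B(1)] x by auto
      then show ?thesis using S C I by auto
    qed
    then show ?thesis using x SN TN unfolding I by blast
  qed
  have "{} \<in> \<I>" "\<I> \<subseteq> Pow N" unfolding I by auto
  then show ?thesis using N down augment unfolding is_matroid_def by blast
qed

text \<open>The matroid of \<open>h\<close> puts \<open>h\<close> and all elements outside \<open>H\<close> into one block of capacity 1. Hence an
  element outside \<open>H\<close> is in conflict with every other element, while \<open>H\<close> is independent.\<close>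

definition hiding_input :: "nat list \<Rightarrow> nat set \<Rightarrow> smkm_input" where
  "hiding_input xs H = SMkM_Input xs
     (map (\<lambda>h. {S. S \<subseteq> set xs \<and> card (S \<inter> insert h (set xs - H)) \<le> 1}) (sorted_list_of_set H))
     (\<lambda>S. real (card S))"

lemma hiding_input_simps [simp]:
  "arrivals (hiding_input xs H) = xs" "ground (hiding_input xs H) = set xs"
  "objective (hiding_input xs H) = (\<lambda>S. real (card S))"
  by (simp_all add: hiding_input_def ground_def)

lemma common_indep_hiding_input:
  assumes H: "H \<subseteq> set xs" "H \<noteq> {}"
  shows "common_indep (hiding_input xs H) = {S. S \<subseteq> set xs \<and> (card S \<le> 1 \<or> S \<subseteq> H)}"
proof -
  have finH: "finite H" using H(1) finite_subset by blast
  have "(\<forall>h\<in>H. card (S \<inter> insert h (set xs - H)) \<le> 1) \<longleftrightarrow> card S \<le> 1 \<or> S \<subseteq> H" (is "?l \<longleftrightarrow> _")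
    if S: "S \<subseteq> set xs" for S
  proof
    assume l: ?l
    show "card S \<le> 1 \<or> S \<subseteq> H"
    proof (rule disjCI)
      assume "\<not> S \<subseteq> H"
      then obtain y where y: "y \<in> S" "y \<notin> H" by blast
      have "z = y" if z: "z \<in> S" for z
      proof -
        \<comment> \<open>The constraint to use is that of \<open>z\<close> itself if
          \<open>z\<close> is hidden, and any one otherwise; its block contains both
          \<open>y\<close> and \<open>z\<close>.\<close>
        obtain h where h: "h \<in> H" "z \<in> H \<longrightarrow> h = z" using H(2) by blast
        have "{y, z} \<subseteq> S \<inter> insert h (set xs - H)" using y z h S by blast
        moreover have "finite S" using S finite_subset by blast
        ultimately have "card {y, z} \<le> card (S \<inter> insert h (set xs - H))" by (intro card_mono) auto
        also have "\<dots> \<le> 1" using l h(1) by blast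
        finally show ?thesis by (simp add: card_insert_if split: if_splits)
      qed
      then have "S = {y}" using y by blast
      then show "card S \<le> 1" by simp
    qed
  next
    assume r: "card S \<le> 1 \<or> S \<subseteq> H"
    show ?l
    proof
      fix h assume "h \<in> H"
      show "card (S \<inter> insert h (set xs - H)) \<le> 1"
      proof (cases "S \<subseteq> H")
        case True
        then have "card (S \<inter> insert h (set xs - H)) \<le> card {h}" by (intro card_mono) auto
        then show ?thesis by simp
      next
        case False
        then have "card S \<le> 1" using r by simp
        moreover have "card (S \<inter> insert h (set xs - H)) \<le> card S"
          using S finite_subset by (intro card_mono) auto
        ultimately show ?thesis by simp
      qed
    qed
  qed
  then show ?thesis
    using finH by (auto simp: common_indep_def ground_def hiding_input_def)
qed

lemma is_partition_matroid_hiding: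
  assumes "finite N" "H \<subseteq> N" "h \<in> H" "2 \<le> card H"
  shows "is_partition_matroid N {S. S \<subseteq> N \<and> card (S \<inter> insert h (N - H)) \<le> 1}"
proof -
  let ?P = "{insert h (N - H), H - {h}}"
  \<comment> \<open>The capacity \<open>card H\<close> cannot be exceeded inside
    \<open>H - {h}\<close>, so the second block imposes no constraint.\<close>
  let ?d = "\<lambda>B. if h \<in> B then 1 else card H"
  have finH: "finite H" using assms finite_subset by blast
  \<comment> \<open>Blocks of a partition are nonempty, which is where \<open>2 \<le> card H\<close>
    enters.\<close>
  have "card (H - {h}) \<noteq> 0" using assms(3,4) by simp
  then have "H - {h} \<noteq> {}" by force
  then have "partition_on N ?P"
    using assms(2,3) by (auto simp: partition_on_def disjoint_def)
  moreover have "card (S \<inter> insert h (N - H)) \<le> 1 \<longleftrightarrow> (\<forall>B\<in>?P. card (S \<inter> B) \<le> ?d B)" for S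
  proof -
    have "card (S \<inter> (H - {h})) \<le> card H" using finH by (intro card_mono) auto
    then show ?thesis
      by (simp only: ball_simps insertI1 if_True if_False Diff_iff not_True_eq_False simp_thms)
  qed
  ultimately show ?thesis unfolding is_partition_matroid_def
    by (intro conjI exI[of _ ?P] exI[of _ ?d] assms(1)) simp_all
qed

lemma Max_card_common_indep_hiding_input:
  assumes "H \<subseteq> set xs" "1 \<le> card H"
  shows "common_rank (hiding_input xs H) = card H" "opt_value (hiding_input xs H) = card H"
proof -
  have H: "H \<noteq> {}" "finite H" using assms by (auto intro: card_ge_0_finite)
  note ci = common_indep_hiding_input[OF assms(1) H(1)]
  have fin: "finite (common_indep (hiding_input xs H))"
    unfolding ci by (rule finite_subset[of _ "Pow (set xs)"]) auto
  have le: "card S \<le> card H" if "S \<in> common_indep (hiding_input xs H)" for S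
    using that assms(2) card_mono[OF H(2)] unfolding ci by fastforce
  have mem: "H \<in> common_indep (hiding_input xs H)" using assms(1) unfolding ci by simp
  show "common_rank (hiding_input xs H) = card H"
    unfolding common_rank_def using fin le mem by (intro Max_eqI) auto
  show "opt_value (hiding_input xs H) = card H"
    unfolding opt_value_def using fin le mem by (intro Max_eqI) auto
qed

lemma submodular_on_card: "finite N \<Longrightarrow> submodular_on N (\<lambda>S. real (card S))"
  unfolding submodular_on_def
  by (metis card_Un_Int finite_subset of_nat_add order_refl)

lemma hiding_input_in_partition_card_inputs:
  assumes "distinct xs" "length xs = n" "set xs \<subseteq> {..<m}" "H \<subseteq> set xs" "card H = k" "2 \<le> k"
  shows "hiding_input xs H \<in> partition_card_inputs m n k"
proof -
  have finH: "finite H" using assms(4) finite_subset by blast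
  have "length (matroids (hiding_input xs H)) = k"
    using assms(5) by (simp add: hiding_input_def)
  moreover have "\<forall>\<I> \<in> set (matroids (hiding_input xs H)). is_partition_matroid (set xs) \<I>"
    using is_partition_matroid_hiding[of "set xs" H] assms(4-6) finH
    by (auto simp: hiding_input_def)
  moreover have "common_rank (hiding_input xs H) = k"
    using Max_card_common_indep_hiding_input[of H xs] assms(4-6) by simp
  ultimately show ?thesis
    using assms(1-3) partition_matroid_is_matroid
    by (auto simp: partition_card_inputs_def smkm_inputs_def submodular_on_card)
qed

subsection \<open>Memory bounds\<close>

text \<open>A query legal on both sides concerns only the empty set, so it cannot tell
  \<open>I\<close> from \<open>J\<close>.\<close>

lemma run_comp_eq_if_disjoint:
  assumes "queries_within I V c" "queries_within J W c" "V \<inter> W = {}"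
    and "{} \<in> common_indep I" "{} \<in> common_indep J" "objective I {} = objective J {}"
  shows "run_comp I c = run_comp J c"
  using assms(1,2)
proof (induction c)
  case (Ask_Indep S g)
  then have "S = {}" using assms(3) by auto
  then show ?case using Ask_Indep assms(4,5) by simp
next
  case (Ask_Value S g)
  then have "S = {}" using assms(3) by auto
  then show ?case using Ask_Value assms(6) by simp
qed simp

text \<open>Without memory, the output step is the same computation on two inputs with disjoint
  ground sets; its output lies in both and is empty. The bound \<open>1 \<le> s\<close> later
  absorbs the constant in \<open>s + 2\<close>.\<close>

lemma memory_positive:
  assumes alg: "streaming_algorithm_for \<C> s R" and ratio: "has_expected_ratio \<C> \<beta> R"
    and IJ: "I \<in> \<C>" "J \<in> \<C>" "ground I \<inter> ground J = {}"
    and empty: "{} \<in> common_indep I" "{} \<in> common_indep J"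
    and val: "objective I {} = 0" "objective J {} = 0" "opt_value I > 0" and "\<beta> > 0"
  shows "1 \<le> s"
proof (rule ccontr)
  assume "\<not> ?thesis"
  then have s: "s = 0" by simp
  have "output_set A I = {}" if A: "A \<in> set_pmf R" for A
  proof -
    have *: "legal_queries A K \<and> memory_within s A K \<and> output_set A K \<in> common_indep K"
      if "K \<in> {I, J}" for K
      using alg A IJ(1,2) that unfolding streaming_algorithm_for_def by blast
    have fin: "queries_within K (ground K) (finish A [])"
        "output_set A K = run_comp K (finish A [])" "output_set A K \<subseteq> ground K" if "K \<in> {I, J}" for K
    proof -
      have "memory_after A K (length (arrivals K)) = []"
        using *[OF that] s unfolding memory_within_def by auto
      then show "queries_within K (ground K) (finish A [])"
        "output_set A K = run_comp K (finish A [])"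
        using *[OF that] unfolding legal_queries_def output_set_def by auto
      show "output_set A K \<subseteq> ground K" using *[OF that] unfolding common_indep_def by blast
    qed
    have "run_comp I (finish A []) = run_comp J (finish A [])"
      using run_comp_eq_if_disjoint[OF fin(1) fin(1) IJ(3) empty] val by simp
    then show ?thesis using fin(2,3)[of I] fin(2,3)[of J] IJ(3) by auto
  qed
  then have "measure_pmf.expectation R (\<lambda>A. objective I (output_set A I)) =
      measure_pmf.expectation R (\<lambda>A. 0)"
    using val by (intro integral_cong_AE) (auto simp: AE_measure_pmf_iff)
  then have "opt_value I / \<beta> \<le> 0"
    using ratio IJ(1) unfolding has_expected_ratio_def by fastforce
  then show False using val(3) \<open>\<beta> > 0\<close> by (simp add: divide_le_0_iff)
qed

section \<open>Averaging over planted inputs\<close>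

abbreviation (input) planted_input :: "nat \<Rightarrow> nat set \<Rightarrow> nat set \<Rightarrow> smkm_input" where
  "planted_input n B P \<equiv> hiding_input (stream_of n B) (stream_name B ` P)"

lemma card_stream_name_image: "card (stream_name B ` P) = card P"
  by (rule card_image) (rule inj_on_subset[OF inj_stream_name subset_UNIV])

lemma planted_input_in_partition_card_inputs:
  assumes "2 * n \<le> m" "P \<subseteq> {..<n}" "card P = k" "2 \<le> k"
  shows "planted_input n B P \<in> partition_card_inputs m n k"
proof (rule hiding_input_in_partition_card_inputs)
  show "distinct (stream_of n B)"
    unfolding stream_of_def by (simp add: distinct_map inj_on_subset[OF inj_stream_name])
  show "set (stream_of n B) \<subseteq> {..<m}"
    using stream_name_less[of _ n B] assms(1) by (force simp: set_stream_of)
  show "stream_name B ` P \<subseteq> set (stream_of n B)" using assms(2) by (auto simp: set_stream_of)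
qed (use assms in \<open>simp_all add: stream_of_def card_stream_name_image\<close>)

text \<open>An output with more than one element consists of hidden elements, so its size is at most
  \<open>k\<close>, and \<open>remembered_if_detected\<close> then provides a known pair of
  positions in \<open>P\<close>.\<close>

lemma card_output_planted_le:
  assumes alg: "streaming_algorithm_for (partition_card_inputs m n k) s R" and A: "A \<in> set_pmf R"
    and "2 * n \<le> m" "P \<subseteq> {..<n}" "card P = k" "2 \<le> k"
  shows "real (card (output_set A (planted_input n B P))) \<le>
    1 + (real k - 1) * of_bool (\<exists>q\<in>P. \<exists>p\<in>P. p \<in> known_positions A s n B q)"
proof (cases "card (output_set A (planted_input n B P)) \<le> 1")
  case True
  then show ?thesis using assms(6) by (auto simp: of_bool_def)
next
  case False
  let ?I = "planted_input n B P" and ?xs = "stream_of n B" and ?H = "stream_name B ` P"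
  have *: "legal_queries A ?I" "memory_within s A ?I" "output_set A ?I \<in> common_indep ?I"
    using alg A planted_input_in_partition_card_inputs[OF assms(3-6)]
    unfolding streaming_algorithm_for_def by auto
  have H: "?H \<subseteq> set ?xs" "?H \<noteq> {}" using assms(4-6) by (auto simp: set_stream_of)
  note ci = common_indep_hiding_input[OF H]
  have out: "output_set A ?I \<subseteq> ?H" using *(3) False unfolding ci by auto
  have finP: "finite P" using assms(4) finite_subset by blast
  have "hides ?I ?H" unfolding hides_def by (simp add: ci)
  moreover have "length ?xs = n" by (simp add: stream_of_def)
  ultimately obtain p q where pq: "p < q" "q < n" "?xs ! p \<in> ?H" "?xs ! q \<in> ?H"
      "?xs ! p \<in> remembered A ?xs q" "length (blind_memory A (take q ?xs)) \<le> s"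
    using remembered_if_detected[of ?I ?H A s] *(1,2) out H(1) False by fastforce
  then have nth: "?xs ! p = stream_name B p" "?xs ! q = stream_name B q"
    by (auto simp: stream_of_def)
  then have "p \<in> P" "q \<in> P" using pq inj_stream_name by (auto simp: inj_image_mem_iff)
  moreover have "p \<in> known_positions A s n B q" using pq nth unfolding known_positions_def by simp
  ultimately have "\<exists>q\<in>P. \<exists>p\<in>P. p \<in> known_positions A s n B q" by blast
  moreover have "card (output_set A ?I) \<le> k"
    using card_mono[OF _ out] finP assms(5) by (simp add: card_stream_name_image)
  ultimately show ?thesis by simp
qed

text \<open>Averaged over all bit sets and position sets, each deterministic algorithm in the
  support has value at most \<open>1 + k * (k - 1) ^ 2 * (s + 2) / (n - 1)\<close>, whereas the
  ratio demands at least \<open>k / (k - \<epsilon>)\<close>.\<close>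

lemma partition_card_memory_bound:
  assumes "2 \<le> k" "k \<le> n" "2 * n \<le> m" and \<epsilon>: "0 \<le> \<epsilon>" "\<epsilon> < real k"
    and alg: "streaming_algorithm_for (partition_card_inputs m n k) s R"
    and ratio: "has_expected_ratio (partition_card_inputs m n k) (real k - \<epsilon>) R"
  shows "(real n - 1) * \<epsilon> \<le> real k ^ 4 * (real s + 2)"
proof -
  let ?J = "Pow {..<n} \<times> {P. P \<subseteq> {..<n} \<and> card P = k}"
  let ?v = "\<lambda>A (B, P). real (card (output_set A (planted_input n B P)))"
  let ?bad = "\<lambda>A (B, P). \<exists>q\<in>P. \<exists>p\<in>P. p \<in> known_positions A s n B q"
  let ?b = "real ((n - 2) choose (k - 2))"
  define N where "N = real (2 ^ n)"
  define c where "c = real (n choose k)"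
  have finJ: "finite ?J" by (intro finite_cartesian_product) (auto intro: finite_subset[of _ "Pow {..<n}"])
  have cardJ: "real (card ?J) = N * c"
    by (simp add: card_cartesian_product card_Pow n_subsets N_def c_def)
  have pointwise: "?v A x \<le> 1 + (real k - 1) * of_bool (?bad A x)"
    if "A \<in> set_pmf R" "x \<in> ?J" for A x
    using that(2) card_output_planted_le[OF alg that(1) assms(3) _ _ assms(1), of "snd x" "fst x"]
    by (cases x) simp
  have total: "(\<Sum>x\<in>?J. ?v A x) \<le> N * c + (real k - 1) * (real n * ((real s + 2) * N) * ?b)"
    if A: "A \<in> set_pmf R" for A
  proof -
    have "{x \<in> ?J. ?bad A x} = {(B, P). B \<subseteq> {..<n} \<and> P \<subseteq> {..<n} \<and> card P = k \<and>
             (\<exists>q\<in>P. \<exists>p\<in>P. p \<in> known_positions A s n B q)}" by auto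
    then have "real (card {x \<in> ?J. ?bad A x}) \<le> real (n * ((s + 2) * 2 ^ n) * ((n - 2) choose (k - 2)))"
      using card_detected_le[OF assms(1,2), of A s] by (simp only: of_nat_le_iff)
    also have "\<dots> = real n * ((real s + 2) * N) * ?b"
      unfolding N_def by (simp only: of_nat_mult of_nat_add of_nat_numeral)
    finally have bad: "real (card {x \<in> ?J. ?bad A x}) \<le> real n * ((real s + 2) * N) * ?b" .
    have "(\<Sum>x\<in>?J. ?v A x) \<le> (\<Sum>x\<in>?J. 1 + (real k - 1) * of_bool (?bad A x))"
      by (intro sum_mono pointwise A)
    also have "\<dots> = card ?J + (real k - 1) * (\<Sum>x\<in>?J. of_bool (?bad A x))"
      by (simp only: sum.distrib sum_distrib_left) simp
    also have "(\<Sum>x\<in>?J. of_bool (?bad A x)) = real (card {x \<in> ?J. ?bad A x})"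
      using finJ by (simp only: of_bool_def flip: sum.inter_filter) simp
    finally show ?thesis
      using mult_left_mono[OF bad, of "real k - 1"] assms(1) unfolding cardJ by linarith
  qed
  \<comment> \<open>Values in the support stay between 0 and \<open>k\<close>; the resulting
    integrability allows the sum over \<open>?J\<close> to be exchanged with the
    expectation.\<close>
  have bounded: "\<bar>?v A x\<bar> \<le> real k" if "A \<in> set_pmf R" "x \<in> ?J" for A x
    using pointwise[OF that] assms(1) by (cases x) (auto simp: of_bool_def split: if_splits)
  have int: "integrable (measure_pmf R) (\<lambda>A. ?v A x)" if "x \<in> ?J" for x
    by (rule measure_pmf.integrable_const_bound[where B = "real k"])
      (use bounded that in \<open>auto simp: AE_measure_pmf_iff\<close>)
  have "real k / (real k - \<epsilon>) \<le> measure_pmf.expectation R (\<lambda>A. ?v A x)" if x: "x \<in> ?J" for x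
  proof -
    obtain B P where x': "x = (B, P)" "P \<subseteq> {..<n}" "card P = k" using x by auto
    have "opt_value (planted_input n B P) = k"
      using x' assms(1) Max_card_common_indep_hiding_input(2)[of "stream_name B ` P" "stream_of n B"]
      by (auto simp: card_stream_name_image set_stream_of)
    then show ?thesis
      using ratio planted_input_in_partition_card_inputs[OF assms(3) x'(2,3) assms(1), of B]
      unfolding has_expected_ratio_def x'(1) by fastforce
  qed
  then have "(\<Sum>x\<in>?J. real k / (real k - \<epsilon>)) \<le> (\<Sum>x\<in>?J. measure_pmf.expectation R (\<lambda>A. ?v A x))"
    by (rule sum_mono)
  also have "\<dots> = measure_pmf.expectation R (\<lambda>A. \<Sum>x\<in>?J. ?v A x)"
    by (rule Bochner_Integration.integral_sum[symmetric]) (rule int)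
  also have "\<dots> \<le> N * c + (real k - 1) * (real n * ((real s + 2) * N) * ?b)"
    by (intro measure_pmf.integral_le_const Bochner_Integration.integrable_sum int)
      (simp_all only: AE_measure_pmf_iff, intro ballI total)
  finally have main: "N * c * (real k / (real k - \<epsilon>)) \<le>
      N * c + (real k - 1) * (real n * ((real s + 2) * N) * ?b)"
    by (simp only: sum_constant cardJ)
  have pos: "N > 0" "c > 0" using assms(2) by (auto simp: N_def c_def)
  have "real (n * (n - 1) * ((n - 2) choose (k - 2))) = real (k * (k - 1) * (n choose k))"
    using binomial_minus_two[OF assms(1,2)] by simp
  then have b: "real n * (real n - 1) * ?b = real k * (real k - 1) * c"
    using assms(1,2) by (simp add: c_def of_nat_diff)
  have "N * (c * (real k / (real k - \<epsilon>) - 1)) \<le> N * ((real k - 1) * (real s + 2) * (real n * ?b))"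
    using main by (simp add: algebra_simps)
  then have "c * (real k / (real k - \<epsilon>) - 1) \<le> (real k - 1) * (real s + 2) * (real n * ?b)"
    using pos(1) by simp
  \<comment> \<open>The factor \<open>real n - 1\<close> completes the product in \<open>b\<close>,
    after which \<open>c\<close> cancels.\<close>
  then have "(real n - 1) * (c * (real k / (real k - \<epsilon>) - 1)) \<le>
      (real n - 1) * ((real k - 1) * (real s + 2) * (real n * ?b))"
    using assms(1,2) by (intro mult_left_mono) auto
  also have "\<dots> = (real k - 1) * (real s + 2) * (real n * (real n - 1) * ?b)" by (simp add: mult_ac)
  also have "\<dots> = c * ((real k - 1) * (real s + 2) * (real k * (real k - 1)))"
    unfolding b by (simp add: mult_ac)
  finally have "c * ((real n - 1) * (real k / (real k - \<epsilon>) - 1)) \<le>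
      c * ((real k - 1) * (real s + 2) * (real k * (real k - 1)))" by (simp add: mult_ac)
  then have *: "(real n - 1) * (real k / (real k - \<epsilon>) - 1) \<le>
      (real k - 1) * (real s + 2) * (real k * (real k - 1))"
    using pos(2) by simp
  \<comment> \<open>The required gain over 1 equals \<open>\<epsilon> / (k - \<epsilon>)\<close>;
    lowering it to \<open>\<epsilon> / k\<close> makes the bound linear in
    \<open>\<epsilon>\<close>.\<close>
  have "\<epsilon> \<le> real k * (real k / (real k - \<epsilon>) - 1)"
  proof -
    have "\<epsilon> / real k \<le> \<epsilon> / (real k - \<epsilon>)" using \<epsilon> by (intro divide_left_mono) auto
    also have "\<dots> = real k / (real k - \<epsilon>) - 1" using \<epsilon> by (simp add: field_simps)
    finally show ?thesis using assms(1) by (simp add: field_simps)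
  qed
  then have "(real n - 1) * \<epsilon> \<le> (real n - 1) * (real k * (real k / (real k - \<epsilon>) - 1))"
    using assms(1,2) by (intro mult_left_mono) auto
  also have "\<dots> \<le> real k * ((real k - 1) * (real s + 2) * (real k * (real k - 1)))"
    using mult_left_mono[OF *, of "real k"] by (simp add: mult_ac)
  also have "\<dots> = (real k * (real k - 1))\<^sup>2 * (real s + 2)" by (simp add: power2_eq_square mult_ac)
  also have "\<dots> \<le> (real k ^ 2)\<^sup>2 * (real s + 2)"
    using assms(1) by (intro mult_right_mono power_mono) (auto simp: power2_eq_square)
  finally show ?thesis by simp
qed

lemma partition_card_memory_positive:
  assumes "2 \<le> k" "k \<le> n" "2 * n \<le> m" "\<beta> > 0"
    and alg: "streaming_algorithm_for (partition_card_inputs m n k) s R"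
    and ratio: "has_expected_ratio (partition_card_inputs m n k) \<beta> R"
  shows "1 \<le> s"
proof (rule memory_positive[OF alg ratio])
  \<comment> \<open>The bit set \<open>{}\<close> yields only even names and \<open>UNIV\<close>
    only odd ones, so the two ground sets are disjoint.\<close>
  let ?I = "planted_input n {} {..<k}" and ?J = "planted_input n UNIV {..<k}"
  have P: "{..<k} \<subseteq> {..<n}" using assms(2) by auto
  show "?I \<in> partition_card_inputs m n k" "?J \<in> partition_card_inputs m n k"
    using planted_input_in_partition_card_inputs[OF assms(3) P _ assms(1)] by auto
  show "ground ?I \<inter> ground ?J = {}" by (auto simp: set_stream_of stream_name_eq_iff)
  have H: "stream_name B ` {..<k} \<subseteq> set (stream_of n B)" "stream_name B ` {..<k} \<noteq> {}" for B
    using P assms(1) by (auto simp: set_stream_of lessThan_empty_iff)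
  show "{} \<in> common_indep ?I" "{} \<in> common_indep ?J"
    by (simp_all add: common_indep_hiding_input[OF H])
  show "0 < opt_value ?I"
    using Max_card_common_indep_hiding_input(2)[OF H(1)] assms(1) by (simp add: card_stream_name_image)
qed (use assms(4) in simp_all)

text \<open>For \<open>n < k\<close> there is no input of common rank \<open>k\<close>; free matroids are used instead.\<close>

lemma smkm_memory_positive:
  assumes "1 \<le> n" "2 * n \<le> m" "\<beta> > 0"
    and alg: "streaming_algorithm_for (smkm_inputs m n k) s R"
    and ratio: "has_expected_ratio (smkm_inputs m n k) \<beta> R"
  shows "1 \<le> s"
proof (rule memory_positive[OF alg ratio])
  let ?free = "\<lambda>B. SMkM_Input (stream_of n B) (replicate k (Pow (set (stream_of n B)))) (\<lambda>S. real (card S))"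
  have [simp]: "ground (?free B) = set (stream_of n B)" for B
    by (simp add: ground_def)
  have ci: "common_indep (?free B) = Pow (set (stream_of n B))" for B
    by (auto simp: common_indep_def)
  have "is_matroid N (Pow N)" if N: "finite N" for N :: "nat set"
  proof -
    have "\<exists>x\<in>T - S. insert x S \<in> Pow N" if "S \<in> Pow N" "T \<in> Pow N" "card S < card T" for S T
    proof -
      have "finite S" using that(1) N by (auto intro: finite_subset)
      then have "\<not> T \<subseteq> S" using that(3) by (meson card_mono not_less)
      then show ?thesis using that(1,2) by blast
    qed
    then show ?thesis using N unfolding is_matroid_def by blast
  qed
  moreover have "distinct (stream_of n B)" for B
    unfolding stream_of_def by (simp add: distinct_map inj_on_subset[OF inj_stream_name])
  moreover have "set (stream_of n B) \<subseteq> {..<m}" for B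
    using stream_name_less[of _ n B] assms(2) by (force simp: set_stream_of)
  ultimately show "?free {} \<in> smkm_inputs m n k" "?free UNIV \<in> smkm_inputs m n k"
    by (auto simp: smkm_inputs_def submodular_on_card) (simp_all add: stream_of_def)
  show "ground (?free {}) \<inter> ground (?free UNIV) = {}"
    by (auto simp: ground_def set_stream_of stream_name_eq_iff)
  show "{} \<in> common_indep (?free {})" "{} \<in> common_indep (?free UNIV)" by (simp_all add: ci)
  have "real (card (set (stream_of n {}))) \<le> opt_value (?free {})"
    unfolding opt_value_def ci by (rule Max_ge) auto
  moreover have "card (set (stream_of n {})) = n" by (simp add: set_stream_of card_stream_name_image)
  ultimately show "0 < opt_value (?free {})" using assms(1) by simp
qed (use assms(3) in simp_all)

theorem theorem1p1:
  "\<exists>c::real. c > 0 \<and>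
     (\<forall>(k::nat) (\<epsilon>::real) (n::nat) (m::nat) (s::nat) (R::stream_alg pmf).
        2 \<le> k \<and> 0 \<le> \<epsilon> \<and> \<epsilon> < real k - 1 \<and> 2 * n \<le> m \<longrightarrow>
        (streaming_algorithm_for (smkm_inputs m n k) s R \<and>
         has_expected_ratio (smkm_inputs m n k) (real k - \<epsilon>) R \<longrightarrow>
         real s \<ge> c * (\<epsilon> * real n / (real k ^ 5 * log 2 (real k)))) \<and>
        (k \<le> n \<and>
         streaming_algorithm_for (partition_card_inputs m n k) s R \<and>
         has_expected_ratio (partition_card_inputs m n k) (real k - \<epsilon>) R \<longrightarrow>
         real s \<ge> c * (\<epsilon> * real n / (real k ^ 5 * log 2 (real k)))))"
\<comment> \<open>The constant collects two losses: \<open>s + 2 \<le> 3 * s\<close> from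
  \<open>1 \<le> s\<close>, and \<open>n \<le> 2 * (n - 1)\<close> from
  \<open>2 \<le> k \<le> n\<close>.\<close>
proof (rule exI[of _ "1/6"], intro conjI allI impI; (elim conjE)?)
  fix k n m s :: nat and \<epsilon> :: real and R :: "stream_alg pmf"
  assume k: "2 \<le> k" and \<epsilon>: "0 \<le> \<epsilon>" "\<epsilon> < real k - 1" and m: "2 * n \<le> m"
  have "log 2 2 \<le> log 2 (real k)" using k by (subst log_le_cancel_iff) auto
  then have log: "1 \<le> log 2 (real k)" by simp
  \<comment> \<open>It suffices to have \<open>k ^ 4\<close> in the denominator, since
    \<open>k ^ 5 * log 2 k\<close> is at least as large.\<close>
  have bound: "real s \<ge> 1/6 * (\<epsilon> * real n / (real k ^ 5 * log 2 (real k)))"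
    if le: "\<epsilon> * real n \<le> 6 * real k ^ 4 * real s"
  proof -
    have "real k ^ 4 \<le> real k ^ 5 * log 2 (real k)"
      using mult_mono[of "real k ^ 4" "real k ^ 5" 1 "log 2 (real k)"] power_increasing[of 4 5 "real k"] k log
      by simp
    then have "\<epsilon> * real n \<le> 6 * (real k ^ 5 * log 2 (real k)) * real s"
      using le mult_right_mono[of "6 * real k ^ 4" "6 * (real k ^ 5 * log 2 (real k))" "real s"] by linarith
    then show ?thesis using k log by (simp add: pos_divide_le_eq mult_ac)
  qed
  have large: "real s \<ge> 1/6 * (\<epsilon> * real n / (real k ^ 5 * log 2 (real k)))"
    if "k \<le> n" "streaming_algorithm_for (partition_card_inputs m n k) s R"
      "has_expected_ratio (partition_card_inputs m n k) (real k - \<epsilon>) R"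
  proof (rule bound)
    have "1 \<le> s" using partition_card_memory_positive[OF k that(1) m _ that(2,3)] \<epsilon> by simp
    then have "real k ^ 4 * (real s + 2) \<le> real k ^ 4 * (3 * real s)" by (intro mult_left_mono) auto
    moreover have "(real n - 1) * \<epsilon> \<le> real k ^ 4 * (real s + 2)"
      using partition_card_memory_bound[OF k that(1) m _ _ that(2,3)] \<epsilon> by simp
    moreover have "real n * \<epsilon> \<le> 2 * (real n - 1) * \<epsilon>"
      using k that(1) \<epsilon>(1) by (intro mult_right_mono) auto
    ultimately have "real n * \<epsilon> \<le> 2 * (real k ^ 4 * (3 * real s))" by linarith
    then show "\<epsilon> * real n \<le> 6 * real k ^ 4 * real s" by (simp add: mult_ac)
  qed
  show "real s \<ge> 1/6 * (\<epsilon> * real n / (real k ^ 5 * log 2 (real k)))"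
    if "k \<le> n" "streaming_algorithm_for (partition_card_inputs m n k) s R"
      "has_expected_ratio (partition_card_inputs m n k) (real k - \<epsilon>) R"
    using large that .
  assume alg: "streaming_algorithm_for (smkm_inputs m n k) s R"
    and ratio: "has_expected_ratio (smkm_inputs m n k) (real k - \<epsilon>) R"
  show "real s \<ge> 1/6 * (\<epsilon> * real n / (real k ^ 5 * log 2 (real k)))"
  proof (cases "k \<le> n")
    case True
    have "partition_card_inputs m n k \<subseteq> smkm_inputs m n k" unfolding partition_card_inputs_def by blast
    then show ?thesis using large[OF True] alg ratio
      unfolding streaming_algorithm_for_def has_expected_ratio_def by blast
  next
    case False
    show ?thesis
    proof (cases "n = 0")
      case n: False
      then have s: "1 \<le> s" using smkm_memory_positive[OF _ m _ alg ratio] \<epsilon> by simp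
      \<comment> \<open>For \<open>n < k\<close> the product \<open>\<epsilon> * n\<close> is at
        most \<open>k ^ 2\<close>, so a single bit of memory already meets the bound.\<close>
      have "\<epsilon> * real n \<le> real k * real k" using False \<epsilon> by (intro mult_mono) auto
      also have "\<dots> \<le> real k ^ 4 * 1" using power_increasing[of 2 4 "real k"] k by (simp add: power2_eq_square)
      also have "\<dots> \<le> real k ^ 4 * (6 * real s)" using s by (intro mult_left_mono) auto
      finally show ?thesis by (intro bound) simp
    qed simp
  qed
qed simp

end
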